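(* Let $\mathcal{P}$ be a poset on a finite set $I$, and let $\eta$ and $\nu$ be nonnesting $(\mathbb{F}_q,\mathcal{P})$-set partitions. If $g\in K_\nu$, then $$\chi_\eta(g)=\chi_\eta(1)\prod_{\substack{i\overset{a}{\frown}j\in\eta\\ i\overset{b}{\frown}j\in\nu}}\theta(ab)$$ if there are no $i\overset{a}{\frown}j\in\eta$ and $k\overset{b}{\frown}l\in\nu$ with $(i,j)\neq(k,l)$ and $i\preceq_\mathcal{P}k\prec_\mathcal{P}l\preceq_\mathcal{P}j$, and $\chi_\eta(g)=0$ otherwise. (The product runs over all pairs $(i,j)$ carrying an arc in both $\eta$, with label $a$, and $\nu$, with label $b$.)
   Context: $\mathbb{F}_q$ is the field with $q$ elements and $\theta:\mathbb{F}_q^+\to\mathbb{C}^\times$ is a fixed nontrivial homomorphism. For a finite set $I$, $M(I)$ is the $\mathbb{F}_q$-algebra of matrices $(x_{ij})_{i,j\in I}$ with entries in $\mathbb{F}_q$ and $(xy)_{ij}=\sum_{k\in I}x_{ik}y_{kj}$; $e_{ij}$ is the matrix with $1$ in position $(i,j)$ and $0$ elsewhere. For a poset $\mathcal{P}$ on $I$, $\mathfrak{u}_\mathcal{P}=\{x\in M(I)\mid x_{ij}=0\text{ unless } i\prec_\mathcal{P} j\}$ and $U_\mathcal{P}=\{1+x\mid x\in\mathfrak{u}_\mathcal{P}\}$ (the pattern group), with matrix multiplication. The bijection $f:U_\mathcal{P}\to\mathfrak{u}_\mathcal{P}$ is $f(1+x)=x$. An $(\mathbb{F}_q,\mathcal{P})$-set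 partition is a set $\eta$ of labeled arcs $i\overset{a}{\frown}j$ ($i,j\in I$, $a\in\mathbb{F}_q^\times$, at most one label for each pair $(i,j)$) such that (1) $i\prec_\mathcal{P}j$ for every arc $i\overset{a}{\frown}j\in\eta$; (2) if $i\overset{a}{\frown}j\in\eta$ and $i\prec_\mathcal{P}k\prec_\mathcal{P}j$, then $\eta$ contains no arc from $i$ to $k$ and no arc from $k$ to $j$ (with any label). It is nonnesting if there are no arcs $i\overset{a}{\frown}j,\ k\overset{b}{\frown}l\in\eta$ with $i\prec_\mathcal{P}k\prec_\mathcal{P}l\prec_\mathcal{P}j$. For $g\in U_\mathcal{P}$, $\mathrm{sml}(g)$ is the set of arcs $i\overset{g_{ij}}{\frown}j$ with $i\prec_\mathcal{P}j$, $g_{ij}\neq0$, and $g_{kl}=0$ whenever $(k,l)\neq(i,j)$ and $i\preceq_\mathcal{P}k\prec_\mathcal{P}l\preceq_\mathcal{P}j$. For $\lambda\in\mathfrak{u}_\mathcal{P}^*$ (the dual space), $\mathrm{big}(\lambda)$ is the set of arcs $i\overset{\lambda(e_{ij})}{\frown}j$ with $i\prec_\mathcal{P}j$, $\lambda(e_{ij})\neq0$, and $\lambda(e_{kl})=0$ whenever $(k,l)\neq(i,j)$ and $k\preceq_\mathcal{P}i\prec_\mathcal{P}j\preceq_\mathcal{P}l$. Both are nonnesting $(\mathbb{F}_q,\mathcal{P})$-set partitions. For nonnesting $(\mathbb{F}_q,\mathcal{P})$-set partitions $\nu,\eta$: $K_\nu=\{g\in U_\mathcal{P}\mid \mathrm{sml}(g)=\nu\}$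 and $\chi_\eta=\sum_{\lambda\in\mathfrak{u}_\mathcal{P}^*,\ \mathrm{big}(\lambda)=\eta}\theta\circ\lambda\circ f$. *)

theory Defs
  imports Complex_Main "HOL-Library.FuncSet" "HOL-Algebra.Group"
begin

text \<open>
  A poset on \<open>I\<close> is given by its reflexive order relation \<open>P :: 'i rel\<close>, with
  \<open>partial_order_on I P\<close>. The finite field is a type \<open>'a :: {field, finite}\<close>.
\<close>

abbreviation poset_le :: "'i \<Rightarrow> 'i rel \<Rightarrow> 'i \<Rightarrow> bool"  ("(_ \<preceq>\<^bsub>_\<^esub> _)" [51, 0, 51] 50)
  where "i \<preceq>\<^bsub>P\<^esub> j \<equiv> (i, j) \<in> P"

abbreviation poset_less :: "'i \<Rightarrow> 'i rel \<Rightarrow> 'i \<Rightarrow> bool"  ("(_ \<prec>\<^bsub>_\<^esub> _)" [51, 0, 51] 50)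
  where "i \<prec>\<^bsub>P\<^esub> j \<equiv> (i, j) \<in> P \<and> i \<noteq> j"


subsection \<open>Matrices indexed by a finite set, and the pattern group\<close>

text \<open>
  A matrix indexed by \<open>I\<close> is a function \<open>'i \<Rightarrow> 'i \<Rightarrow> 'a\<close> that vanishes off \<open>I \<times> I\<close>, so that
  equality of matrices is equality of functions and \<open>I\<close> may be any finite set, also the empty one.
\<close>

type_synonym ('i, 'a) matr = "'i \<Rightarrow> 'i \<Rightarrow> 'a"

definition matr_add :: "('i, 'a::field) matr \<Rightarrow> ('i, 'a) matr \<Rightarrow> ('i, 'a) matr"
  where "matr_add x y = (\<lambda>i j. x i j + y i j)"

definition matr_smult :: "'a::field \<Rightarrow> ('i, 'a) matr \<Rightarrow> ('i, 'a) matr"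
  where "matr_smult c x = (\<lambda>i j. c * x i j)"

definition matr_mult :: "'i set \<Rightarrow> ('i, 'a::field) matr \<Rightarrow> ('i, 'a) matr \<Rightarrow> ('i, 'a) matr"
  where "matr_mult I x y = (\<lambda>i j. \<Sum>k\<in>I. x i k * y k j)"

definition matr_one :: "'i set \<Rightarrow> ('i, 'a::field) matr"
  where "matr_one I = (\<lambda>i j. if i \<in> I \<and> i = j then 1 else 0)"

definition matr_unit :: "'i \<Rightarrow> 'i \<Rightarrow> ('i, 'a::field) matr"
  where "matr_unit i j = (\<lambda>k l. if k = i \<and> l = j then 1 else 0)"

definition matr_algebra :: "'i set \<Rightarrow> ('i, 'a::field) matr set"
  where "matr_algebra I = {x. \<forall>i j. x i j \<noteq> 0 \<longrightarrow> i \<in> I \<and> j \<in> I}"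

definition pattern_algebra :: "'i set \<Rightarrow> 'i rel \<Rightarrow> ('i, 'a::field) matr set"
  where "pattern_algebra I P = {x \<in> matr_algebra I. \<forall>i j. \<not> i \<prec>\<^bsub>P\<^esub> j \<longrightarrow> x i j = 0}"

definition pattern_group :: "'i set \<Rightarrow> 'i rel \<Rightarrow> ('i, 'a::field) matr monoid"
  where "pattern_group I P =
    \<lparr>carrier = matr_add (matr_one I) ` pattern_algebra I P,
     mult = matr_mult I,
     one = matr_one I\<rparr>"

definition pattern_log :: "'i set \<Rightarrow> ('i, 'a::field) matr \<Rightarrow> ('i, 'a) matr"
  where "pattern_log I g = (\<lambda>i j. g i j - matr_one I i j)"

lemma pattern_log_one_plus: "pattern_log I (matr_add (matr_one I) x) = x"
  by (simp add: pattern_log_def matr_add_def)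

text \<open>
  Functionals are \<open>undefined\<close> outside the pattern algebra, so that each element of the dual space
  is represented by exactly one function and sums over the dual space count it once.
\<close>

definition pattern_dual :: "'i set \<Rightarrow> 'i rel \<Rightarrow> (('i, 'a::field) matr \<Rightarrow> 'a) set"
  where "pattern_dual I P =
    {\<phi> \<in> pattern_algebra I P \<rightarrow>\<^sub>E UNIV.
       (\<forall>x\<in>pattern_algebra I P. \<forall>y\<in>pattern_algebra I P. \<phi> (matr_add x y) = \<phi> x + \<phi> y) \<and>
       (\<forall>c. \<forall>x\<in>pattern_algebra I P. \<phi> (matr_smult c x) = c * \<phi> x)}"


subsection \<open>Labeled set partitions\<close>

text \<open>The triple \<open>(i, a, j)\<close> is the arc from \<open>i\<close> to \<open>j\<close> with label \<open>a\<close>.\<close>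

type_synonym ('i, 'a) arc = "'i \<times> 'a \<times> 'i"

definition labeled_set_partition :: "'i rel \<Rightarrow> ('i, 'a::field) arc set \<Rightarrow> bool"
  where "labeled_set_partition P \<eta> \<longleftrightarrow>
    (\<forall>i a j. (i, a, j) \<in> \<eta> \<longrightarrow> a \<noteq> 0) \<and>
    (\<forall>i a b j. (i, a, j) \<in> \<eta> \<and> (i, b, j) \<in> \<eta> \<longrightarrow> a = b) \<and>
    (\<forall>i a j. (i, a, j) \<in> \<eta> \<longrightarrow> i \<prec>\<^bsub>P\<^esub> j) \<and>
    (\<forall>i a j k. (i, a, j) \<in> \<eta> \<and> i \<prec>\<^bsub>P\<^esub> k \<and> k \<prec>\<^bsub>P\<^esub> j \<longrightarrow>
       (\<nexists>b. (i, b, k) \<in> \<eta>) \<and> (\<nexists>b. (k, b, j) \<in> \<eta>))"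

definition nonnesting :: "'i rel \<Rightarrow> ('i, 'a) arc set \<Rightarrow> bool"
  where "nonnesting P \<eta> \<longleftrightarrow>
    (\<nexists>i a j k b l. (i, a, j) \<in> \<eta> \<and> (k, b, l) \<in> \<eta> \<and> i \<prec>\<^bsub>P\<^esub> k \<and> k \<prec>\<^bsub>P\<^esub> l \<and> l \<prec>\<^bsub>P\<^esub> j)"

definition sml :: "'i rel \<Rightarrow> ('i, 'a::field) matr \<Rightarrow> ('i, 'a) arc set"
  where "sml P g = {(i, a, j). i \<prec>\<^bsub>P\<^esub> j \<and> a = g i j \<and> a \<noteq> 0 \<and>
    (\<forall>k l. (k, l) \<noteq> (i, j) \<and> i \<preceq>\<^bsub>P\<^esub> k \<and> k \<prec>\<^bsub>P\<^esub> l \<and> l \<preceq>\<^bsub>P\<^esub> j \<longrightarrow> g k l = 0)}"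

definition big :: "'i rel \<Rightarrow> (('i, 'a::field) matr \<Rightarrow> 'a) \<Rightarrow> ('i, 'a) arc set"
  where "big P \<phi> = {(i, a, j). i \<prec>\<^bsub>P\<^esub> j \<and> a = \<phi> (matr_unit i j) \<and> a \<noteq> 0 \<and>
    (\<forall>k l. (k, l) \<noteq> (i, j) \<and> k \<preceq>\<^bsub>P\<^esub> i \<and> i \<prec>\<^bsub>P\<^esub> j \<and> j \<preceq>\<^bsub>P\<^esub> l \<longrightarrow> \<phi> (matr_unit k l) = 0)}"


subsection \<open>Superclasses and supercharacters\<close>

definition nonnesting_superclass ::
    "'i set \<Rightarrow> 'i rel \<Rightarrow> ('i, 'a::field) arc set \<Rightarrow> ('i, 'a) matr set"
  where "nonnesting_superclass I P \<nu> = {g \<in> carrier (pattern_group I P). sml P g = \<nu>}"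

definition nonnesting_supercharacter ::
    "('a::field \<Rightarrow> complex) \<Rightarrow> 'i set \<Rightarrow> 'i rel \<Rightarrow> ('i, 'a) arc set \<Rightarrow> ('i, 'a) matr \<Rightarrow> complex"
  where "nonnesting_supercharacter \<theta> I P \<eta> g =
    (\<Sum>\<phi> | \<phi> \<in> pattern_dual I P \<and> big P \<phi> = \<eta>. (\<theta> \<circ> \<phi> \<circ> pattern_log I) g)"

definition nontrivial_additive_character :: "('a::field \<Rightarrow> complex) \<Rightarrow> bool"
  where "nontrivial_additive_character \<theta> \<longleftrightarrow>
    (\<forall>x. \<theta> x \<noteq> 0) \<and> (\<forall>x y. \<theta> (x + y) = \<theta> x * \<theta> y) \<and> (\<exists>x. \<theta> x \<noteq> 1)"

end

theory Submission
  imports Defs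
begin

text \<open>
  Order the pairs \<open>i \<prec> j\<close> by inclusion of intervals. Then \<open>big \<phi>\<close> records the maximal elements of
  the support of \<open>\<phi>\<close>, and \<open>sml g\<close> the minimal elements of the support of \<open>g - 1\<close>; a nonnesting set
  partition is an antichain. Hence \<open>big \<phi> = \<eta>\<close> fixes the values of \<open>\<phi>\<close> on the arcs of \<open>\<eta>\<close>,
  leaves the pairs strictly below some arc of \<open>\<eta>\<close> free, and forces \<open>\<phi>\<close> to vanish on all others.
  If \<open>g\<close> is nonzero at a free pair, translating \<open>\<phi>\<close> in that coordinate multiplies the sum
  defining the supercharacter by a nontrivial value of \<open>\<theta>\<close>, so the sum is zero. Otherwise all its
  terms are equal.
\<close>

text \<open>Proper containment of intervals: \<open>p\<close> and \<open>q\<close> are read as pairs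
  of endpoints. Comparability of the two endpoints is not built in.\<close>

definition strictly_under :: "'i rel \<Rightarrow> 'i \<times> 'i \<Rightarrow> 'i \<times> 'i \<Rightarrow> bool"
  where "strictly_under P p q \<longleftrightarrow> p \<noteq> q \<and> (fst q, fst p) \<in> P \<and> (snd p, snd q) \<in> P"

section \<open>Additive characters\<close>

lemma additive_character_zero:
  assumes "nontrivial_additive_character \<theta>"
  shows "\<theta> 0 = 1"
proof -
  have "\<theta> 0 * \<theta> 0 = \<theta> 0 * 1" "\<theta> 0 \<noteq> 0"
    using assms unfolding nontrivial_additive_character_def by (metis add_0 mult.right_neutral)+
  then show ?thesis by simp
qed

lemma additive_character_sum:
  assumes "nontrivial_additive_character \<theta>"
  shows "\<theta> (sum f A) = (\<Prod>x\<in>A. \<theta> (f x))"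
proof (induction A rule: infinite_finite_induct)
  case (insert x A)
  then show ?case using assms by (simp add: nontrivial_additive_character_def)
qed (simp_all add: additive_character_zero[OF assms])

text \<open>Adds \<open>t\<close> times the coordinate function at \<open>(k, l)\<close>. The
  restriction keeps the value \<open>undefined\<close> off the pattern algebra, as membership in
  \<open>pattern_dual\<close> requires.\<close>

definition dual_translate ::
    "'i set \<Rightarrow> 'i rel \<Rightarrow> 'i \<Rightarrow> 'i \<Rightarrow> 'a::field \<Rightarrow> (('i, 'a) matr \<Rightarrow> 'a) \<Rightarrow> (('i, 'a) matr \<Rightarrow> 'a)"
  where "dual_translate I P k l t \<phi> = (\<lambda>x\<in>pattern_algebra I P. \<phi> x + t * x k l)"

locale finite_poset =
  fixes I :: "'i set" and P :: "'i rel"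
  assumes finite_I: "finite I" and po: "partial_order_on I P"
begin

section \<open>The poset and containment of intervals\<close>

lemma in_carrier: "(i, j) \<in> P \<Longrightarrow> i \<in> I \<and> j \<in> I"
  using po by (auto simp: partial_order_on_def preorder_on_def)

lemma refl_le: "i \<in> I \<Longrightarrow> (i, i) \<in> P"
  using po by (auto simp: partial_order_on_def preorder_on_def refl_on_def)

lemma trans_le: "(i, j) \<in> P \<Longrightarrow> (j, k) \<in> P \<Longrightarrow> (i, k) \<in> P"
  using po by (auto simp: partial_order_on_def preorder_on_def dest: transD)

lemma antisym_le: "(i, j) \<in> P \<Longrightarrow> (j, i) \<in> P \<Longrightarrow> i = j"
  using po by (auto simp: partial_order_on_def dest: antisymD)

lemma less_between: "(k, i) \<in> P \<Longrightarrow> i \<prec>\<^bsub>P\<^esub> j \<Longrightarrow> (j, l) \<in> P \<Longrightarrow> k \<prec>\<^bsub>P\<^esub> l"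
  by (metis trans_le antisym_le)

lemma strictly_under_trans:
  "strictly_under P p q \<Longrightarrow> strictly_under P q r \<Longrightarrow> strictly_under P p r"
  unfolding strictly_under_def by (metis trans_le antisym_le prod.expand)

lemma strictly_under_asym: "strictly_under P p q \<Longrightarrow> \<not> strictly_under P q p"
  unfolding strictly_under_def by (metis antisym_le prod.expand)

lemma asymp_on_strictly_under: "asymp_on A (strictly_under P)"
  by (rule asymp_onI) (rule strictly_under_asym)

lemma transp_on_strictly_under: "transp_on A (strictly_under P)"
  by (rule transp_onI) (rule strictly_under_trans)

lemma finite_P: "finite P"
  by (rule finite_subset[of P "I \<times> I"]) (use finite_I in_carrier in auto)

lemma exists_minimal:
  assumes "A \<subseteq> P" "A \<noteq> {}"
  shows "\<exists>m\<in>A. \<forall>x\<in>A. \<not> strictly_under P x m"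
proof -
  have "finite A" using assms finite_P finite_subset by blast
  then have "\<exists>m\<in>A. \<forall>x\<in>A. x \<noteq> m \<longrightarrow> \<not> strictly_under P x m"
    by (rule Finite_Set.bex_min_element[OF _ asymp_on_strictly_under transp_on_strictly_under assms(2)])
  then show ?thesis by (auto simp: strictly_under_def)
qed

lemma exists_maximal:
  assumes "A \<subseteq> P" "A \<noteq> {}"
  shows "\<exists>m\<in>A. \<forall>x\<in>A. \<not> strictly_under P m x"
proof -
  have "finite A" using assms finite_P finite_subset by blast
  then have "\<exists>m\<in>A. \<forall>x\<in>A. x \<noteq> m \<longrightarrow> \<not> strictly_under P m x"
    by (rule Finite_Set.bex_max_element[OF _ asymp_on_strictly_under transp_on_strictly_under assms(2)])
  then show ?thesis by (auto simp: strictly_under_def)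
qed

section \<open>Extremal elements of supports and nonnesting set partitions\<close>

lemma big_iff:
  "(i, a, j) \<in> big P \<phi> \<longleftrightarrow> i \<prec>\<^bsub>P\<^esub> j \<and> a = \<phi> (matr_unit i j) \<and> a \<noteq> 0 \<and>
    (\<forall>k l. strictly_under P (i, j) (k, l) \<longrightarrow> \<phi> (matr_unit k l) = 0)"
  unfolding big_def strictly_under_def by auto

text \<open>Everything above a strict pair is strict by \<open>less_between\<close>, so
  \<open>big_iff\<close> quantifies over all pairs above. Here strictness of \<open>(k, l)\<close>
  has to be demanded: an interval also contains diagonal pairs, where elements of the group have
  entry 1.\<close>

lemma sml_iff:
  "(i, a, j) \<in> sml P g \<longleftrightarrow> i \<prec>\<^bsub>P\<^esub> j \<and> a = g i j \<and> a \<noteq> 0 \<and>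
    (\<forall>k l. k \<prec>\<^bsub>P\<^esub> l \<and> strictly_under P (k, l) (i, j) \<longrightarrow> g k l = 0)"
  unfolding sml_def strictly_under_def by auto

text \<open>Among the finitely many nonzero strict pairs inside \<open>(k, l)\<close> choose a
  minimal one. A nonzero strict pair below it would again lie inside \<open>(k, l)\<close>, so it is
  minimal in the whole support.\<close>

lemma exists_sml_below:
  assumes "k \<prec>\<^bsub>P\<^esub> l" "g k l \<noteq> 0"
  obtains k' l' where "(k', g k' l', l') \<in> sml P g" "(k, k') \<in> P" "(l', l) \<in> P"
proof -
  let ?A = "{(k', l'). k' \<prec>\<^bsub>P\<^esub> l' \<and> (k, k') \<in> P \<and> (l', l) \<in> P \<and> g k' l' \<noteq> 0}"
  have "?A \<subseteq> P" "(k, l) \<in> ?A" using assms refl_le in_carrier by auto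
  then obtain m where m: "m \<in> ?A" "\<forall>x\<in>?A. \<not> strictly_under P x m"
    using exists_minimal[of ?A] by blast
  obtain k' l' where kl: "m = (k', l')" by fastforce
  have "(k', g k' l', l') \<in> sml P g"
    unfolding sml_iff using m kl by (auto simp: strictly_under_def intro: trans_le)
  then show thesis using that m kl by auto
qed

lemma exists_big_above:
  assumes "k \<prec>\<^bsub>P\<^esub> l" "\<phi> (matr_unit k l) \<noteq> 0"
  obtains i a j where "(i, a, j) \<in> big P \<phi>" "(i, k) \<in> P" "(l, j) \<in> P"
proof -
  let ?A = "{(i, j). (i, k) \<in> P \<and> (l, j) \<in> P \<and> \<phi> (matr_unit i j) \<noteq> 0}"
  have "(i, j) \<in> P" if "(i, k) \<in> P" "(l, j) \<in> P" for i j
    using that assms(1) trans_le by blast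
  then have "?A \<subseteq> P" by auto
  moreover have "(k, l) \<in> ?A" using assms refl_le in_carrier by auto
  ultimately obtain m where m: "m \<in> ?A" "\<forall>x\<in>?A. \<not> strictly_under P m x"
    using exists_maximal[of ?A] by blast
  obtain i j where ij: "m = (i, j)" by fastforce
  have "i \<prec>\<^bsub>P\<^esub> j" using m ij assms less_between[of i k l j] by auto
  then have "(i, \<phi> (matr_unit i j), j) \<in> big P \<phi>"
    unfolding big_iff using m ij by (auto simp: strictly_under_def intro: trans_le)
  then show thesis using that m ij by auto
qed

text \<open>An arc strictly inside \<open>(i, j)\<close> either shares an endpoint with it, which
  the set partition condition excludes, or has both endpoints strictly between, which nonnesting
  excludes.\<close>

lemma nonnesting_antichain:
  assumes "labeled_set_partition P \<eta>" "nonnesting P \<eta>" "(i, a, j) \<in> \<eta>" "(k, b, l) \<in> \<eta>"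
  shows "\<not> strictly_under P (k, l) (i, j)"
proof
  assume u: "strictly_under P (k, l) (i, j)"
  then have le: "(i, k) \<in> P" "(l, j) \<in> P" "(i, j) \<noteq> (k, l)"
    by (auto simp: strictly_under_def)
  have kl: "k \<prec>\<^bsub>P\<^esub> l"
    using assms(1,4) unfolding labeled_set_partition_def by blast
  have part: "\<And>k b. i \<prec>\<^bsub>P\<^esub> k \<Longrightarrow> k \<prec>\<^bsub>P\<^esub> j \<Longrightarrow> (i, b, k) \<notin> \<eta> \<and> (k, b, j) \<notin> \<eta>"
    using assms(1,3) unfolding labeled_set_partition_def by blast
  have nest: "\<not> (i \<prec>\<^bsub>P\<^esub> k \<and> k \<prec>\<^bsub>P\<^esub> l \<and> l \<prec>\<^bsub>P\<^esub> j)"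
    using assms(2-4) unfolding nonnesting_def by blast
  show False using le kl part[of k b] part[of l b] nest assms(4) by (cases "i = k"; cases "l = j") auto
qed

text \<open>Replaces maximality by conditions on single coordinates, so that the effect of changing
  one coordinate can be checked directly.\<close>

lemma big_eq_iff:
  assumes "labeled_set_partition P \<eta>" "nonnesting P \<eta>"
  shows "big P \<phi> = \<eta> \<longleftrightarrow>
    (\<forall>i a j. (i, a, j) \<in> \<eta> \<longrightarrow> \<phi> (matr_unit i j) = a) \<and>
    (\<forall>k l. k \<prec>\<^bsub>P\<^esub> l \<and> \<phi> (matr_unit k l) \<noteq> 0 \<longrightarrow>
      (\<exists>i a j. (i, a, j) \<in> \<eta> \<and> (i, k) \<in> P \<and> (l, j) \<in> P))"
    (is "_ \<longleftrightarrow> ?R")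
proof
  assume \<eta>: "big P \<phi> = \<eta>"
  show ?R
  proof (intro conjI allI impI)
    fix i a j assume "(i, a, j) \<in> \<eta>"
    then show "\<phi> (matr_unit i j) = a" unfolding \<eta>[symmetric] big_iff by simp
  next
    fix k l assume "k \<prec>\<^bsub>P\<^esub> l \<and> \<phi> (matr_unit k l) \<noteq> 0"
    then show "\<exists>i a j. (i, a, j) \<in> \<eta> \<and> (i, k) \<in> P \<and> (l, j) \<in> P"
      using exists_big_above[of k l \<phi>] \<eta> by blast
  qed
next
  assume R: ?R
  have arc: "i \<prec>\<^bsub>P\<^esub> j \<and> a \<noteq> 0" if "(i, a, j) \<in> \<eta>" for i a j
    using that assms(1) unfolding labeled_set_partition_def by blast
  \<comment> \<open>A nonzero value strictly above an arc would lie under a second arc, making two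
    arcs of the antichain comparable.\<close>
  have zero: "\<phi> (matr_unit k l) = 0"
    if "(i, a, j) \<in> \<eta>" "strictly_under P (i, j) (k, l)" for i a j k l
  proof (rule ccontr)
    assume "\<phi> (matr_unit k l) \<noteq> 0"
    moreover have "k \<prec>\<^bsub>P\<^esub> l"
      using that arc[OF that(1)] less_between[of k i j l] by (auto simp: strictly_under_def)
    ultimately obtain i' a' j' where "(i', a', j') \<in> \<eta>" "(i', k) \<in> P" "(l, j') \<in> P"
      using R by blast
    then show False
      using nonnesting_antichain[OF assms \<open>(i', a', j') \<in> \<eta>\<close> that(1)] that(2)
        strictly_under_trans[of "(i, j)" "(k, l)" "(i', j')"]
      by (auto simp: strictly_under_def)
  qed
  have "(i, a, j) \<in> big P \<phi> \<longleftrightarrow> (i, a, j) \<in> \<eta>" for i a j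
  proof
    assume "(i, a, j) \<in> \<eta>"
    then show "(i, a, j) \<in> big P \<phi>" unfolding big_iff using R arc zero by metis
  next
    \<comment> \<open>The pair lies under an arc of \<open>\<eta>\<close>. The functional is nonzero
      on that arc, so maximality forces the two pairs to coincide.\<close>
    assume b: "(i, a, j) \<in> big P \<phi>"
    then obtain i' a' j' where "(i', a', j') \<in> \<eta>" "(i', i) \<in> P" "(j, j') \<in> P"
      using R unfolding big_iff by metis
    moreover have "\<phi> (matr_unit i' j') \<noteq> 0" using calculation R arc by blast
    ultimately have "(i', j') = (i, j)"
      using b unfolding big_iff strictly_under_def by force
    then show "(i, a, j) \<in> \<eta>" using b R \<open>(i', a', j') \<in> \<eta>\<close> unfolding big_iff by auto
  qed
  then show "big P \<phi> = \<eta>" by auto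
qed

section \<open>Coordinates on the pattern algebra and its dual\<close>

lemma pattern_algebra_iff:
  "x \<in> pattern_algebra I P \<longleftrightarrow> (\<forall>i j. \<not> i \<prec>\<^bsub>P\<^esub> j \<longrightarrow> x i j = 0)"
  unfolding pattern_algebra_def matr_algebra_def using in_carrier by blast

lemma matr_unit_in_pattern_algebra:
  "i \<prec>\<^bsub>P\<^esub> j \<Longrightarrow> matr_unit i j \<in> pattern_algebra I P"
  by (auto simp: pattern_algebra_iff matr_unit_def)

lemma pattern_dual_zero:
  assumes "\<phi> \<in> pattern_dual I P"
  shows "\<phi> (\<lambda>i j. 0) = 0"
proof -
  have z: "(\<lambda>i j. 0) \<in> pattern_algebra I P"
    by (simp add: pattern_algebra_iff)
  then have "\<phi> (matr_smult 0 (\<lambda>i j. 0)) = 0 * \<phi> (\<lambda>i j. 0)"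
    using assms unfolding pattern_dual_def by blast
  then show ?thesis by (simp add: matr_smult_def)
qed

lemma pattern_dual_expand:
  fixes x :: "('i, 'a::field) matr"
  assumes \<phi>: "\<phi> \<in> pattern_dual I P" and x: "x \<in> pattern_algebra I P"
  shows "\<phi> x = (\<Sum>(i, j)\<in>{(i, j). i \<prec>\<^bsub>P\<^esub> j}. x i j * \<phi> (matr_unit i j))"
proof -
  let ?S = "{(i, j). i \<prec>\<^bsub>P\<^esub> j}"
  \<comment> \<open>The truncation of \<open>x\<close> to the positions in \<open>A\<close>.
    Inserting one position adds one multiple of a matrix unit, so linearity carries an induction on
    \<open>A\<close>.\<close>
  let ?x = "\<lambda>A i j. if (i, j) \<in> A then x i j else 0"
  have fin: "finite ?S" using finite_P by (rule rev_finite_subset) auto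
  have "\<phi> (?x A) = (\<Sum>(i, j)\<in>A. x i j * \<phi> (matr_unit i j))" if "A \<subseteq> ?S" for A
    using finite_subset[OF that fin] that
  proof (induction A)
    case empty
    then show ?case using pattern_dual_zero[OF \<phi>] by simp
  next
    case (insert p A)
    obtain i j where p: "p = (i, j)" by fastforce
    have ij: "i \<prec>\<^bsub>P\<^esub> j" using insert.prems p by auto
    have u: "(matr_unit i j :: ('i, 'a) matr) \<in> pattern_algebra I P"
      using matr_unit_in_pattern_algebra[OF ij] .
    have su: "matr_smult (x i j) (matr_unit i j) \<in> pattern_algebra I P"
      using u by (auto simp: pattern_algebra_iff matr_smult_def)
    have xA: "?x A \<in> pattern_algebra I P"
      using x by (simp add: pattern_algebra_iff)
    have "?x (insert p A) = matr_add (matr_smult (x i j) (matr_unit i j)) (?x A)"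
      using insert.hyps p by (intro ext) (auto simp: matr_add_def matr_smult_def matr_unit_def)
    then have "\<phi> (?x (insert p A)) = x i j * \<phi> (matr_unit i j) + \<phi> (?x A)"
      using \<phi> u su xA unfolding pattern_dual_def by simp
    then show ?case using insert p by simp
  qed
  from this[of ?S] have "\<phi> (?x ?S) = (\<Sum>(i, j)\<in>?S. x i j * \<phi> (matr_unit i j))" by blast
  moreover have "?x ?S = x"
    using x by (intro ext) (auto simp: pattern_algebra_iff)
  ultimately show ?thesis by simp
qed

section \<open>Translations of functionals\<close>

lemma dual_translate_in_pattern_dual:
  assumes "\<phi> \<in> pattern_dual I P"
  shows "dual_translate I P k l (t :: 'a :: field) \<phi> \<in> pattern_dual I P"
proof -
  have "matr_add x y \<in> pattern_algebra I P"
    if "x \<in> pattern_algebra I P" "y \<in> pattern_algebra I P" for x y :: "('i, 'a) matr"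
    using that by (simp add: pattern_algebra_iff matr_add_def)
  moreover have "matr_smult c x \<in> pattern_algebra I P"
    if "x \<in> pattern_algebra I P" for c and x :: "('i, 'a) matr"
    using that by (simp add: pattern_algebra_iff matr_smult_def)
  ultimately show ?thesis
    using assms unfolding pattern_dual_def dual_translate_def
    by (auto simp: matr_add_def matr_smult_def algebra_simps)
qed

lemma dual_translate_inverse:
  assumes "\<phi> \<in> pattern_dual I P"
  shows "dual_translate I P k l (- t) (dual_translate I P k l t \<phi>) = \<phi>"
  using assms unfolding pattern_dual_def dual_translate_def
  by (intro ext) (auto simp: PiE_def extensional_def)

lemma dual_translate_matr_unit:
  "i \<prec>\<^bsub>P\<^esub> j \<Longrightarrow> dual_translate I P k l t \<phi> (matr_unit i j) =
    \<phi> (matr_unit i j) + (if (k, l) = (i, j) then t else 0)"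
  using matr_unit_in_pattern_algebra[of i j] by (auto simp: dual_translate_def matr_unit_def)

text \<open>The pair \<open>(k, l)\<close> is no arc, since arcs form an antichain, so the
  prescribed values survive. It lies under an arc, so any value is allowed there.\<close>

lemma big_dual_translate:
  assumes \<eta>: "labeled_set_partition P \<eta>" "nonnesting P \<eta>"
    and "(i, a, j) \<in> \<eta>" "strictly_under P (k, l) (i, j)" "big P \<phi> = \<eta>"
  shows "big P (dual_translate I P k l t \<phi>) = \<eta>"
proof -
  have R: "\<phi> (matr_unit i j) = a" if "(i, a, j) \<in> \<eta>" for i a j
    using assms(5) that big_iff by metis
  have S: "\<exists>i a j. (i, a, j) \<in> \<eta> \<and> (i, k) \<in> P \<and> (l, j) \<in> P"
    if "k \<prec>\<^bsub>P\<^esub> l" "\<phi> (matr_unit k l) \<noteq> 0" for k l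
    using assms(5) big_eq_iff[OF \<eta>, of \<phi>] that by blast
  have arc: "i \<prec>\<^bsub>P\<^esub> j" if "(i, a, j) \<in> \<eta>" for i a j
    using that \<eta>(1) unfolding labeled_set_partition_def by blast
  have "dual_translate I P k l t \<phi> (matr_unit i' j') = a'" if "(i', a', j') \<in> \<eta>" for i' a' j'
    using nonnesting_antichain[OF \<eta> assms(3) that] assms(4) R[OF that]
    by (auto simp: dual_translate_matr_unit[OF arc[OF that]])
  moreover have "\<exists>i a j. (i, a, j) \<in> \<eta> \<and> (i, k') \<in> P \<and> (l', j) \<in> P"
    if "k' \<prec>\<^bsub>P\<^esub> l'" "dual_translate I P k l t \<phi> (matr_unit k' l') \<noteq> 0" for k' l'
  proof (cases "(k, l) = (k', l')")
    case True
    then show ?thesis using assms(3,4) by (auto simp: strictly_under_def)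
  next
    case False
    then show ?thesis using that S by (simp add: dual_translate_matr_unit[OF that(1)] split: if_splits)
  qed
  ultimately show ?thesis unfolding big_eq_iff[OF \<eta>] by blast
qed

section \<open>Values of supercharacters\<close>

lemma supercharacter_eq_zero:
  assumes \<theta>: "nontrivial_additive_character \<theta>"
    and \<eta>: "labeled_set_partition P \<eta>" "nonnesting P \<eta>"
    and arc: "(i, a, j) \<in> \<eta>" "strictly_under P (k, l) (i, j)"
    and g: "pattern_log I g \<in> pattern_algebra I P" "pattern_log I g k l \<noteq> 0"
  shows "nonnesting_supercharacter \<theta> I P \<eta> g = 0"
proof -
  let ?x = "pattern_log I g"
  let ?D = "{\<phi>. \<phi> \<in> pattern_dual I P \<and> big P \<phi> = \<eta>}"
  obtain s where s: "\<theta> s \<noteq> 1" using \<theta> unfolding nontrivial_additive_character_def by blast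
  \<comment> \<open>Chosen so that translation by \<open>t\<close> changes the value at
    \<open>?x\<close> by exactly \<open>s\<close>.\<close>
  define t where "t = s / ?x k l"
  let ?T = "dual_translate I P k l"
  have mem: "?T r \<phi> \<in> ?D" if "\<phi> \<in> ?D" for r \<phi>
    using that dual_translate_in_pattern_dual big_dual_translate[OF \<eta> arc] by blast
  have shift: "\<theta> (?T t \<phi> ?x) = \<theta> s * \<theta> (\<phi> ?x)" for \<phi>
    using \<theta> g by (simp add: dual_translate_def t_def nontrivial_additive_character_def)
  \<comment> \<open>Translation by \<open>t\<close> permutes \<open>?D\<close>, with translation by
    \<open>- t\<close> as inverse. The sum therefore equals \<open>\<theta> s\<close> times itself,
    and \<open>\<theta> s \<noteq> 1\<close>.\<close>
  have "(\<Sum>\<phi>\<in>?D. \<theta> (\<phi> ?x)) = (\<Sum>\<phi>\<in>?D. \<theta> (?T t \<phi> ?x))"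
    using dual_translate_inverse[of _ k l t] dual_translate_inverse[of _ k l "- t"] mem
    by (intro sum.reindex_bij_witness[of _ "?T t" "?T (- t)"]) auto
  also have "\<dots> = \<theta> s * (\<Sum>\<phi>\<in>?D. \<theta> (\<phi> ?x))" by (simp add: shift sum_distrib_left)
  finally show ?thesis using s by (simp add: nonnesting_supercharacter_def)
qed

text \<open>Each summand is \<open>\<theta> 0 = 1\<close>, so the sum counts the functionals. On an
  infinite set \<open>sum\<close> and \<open>card\<close> both default to 0, so the count needs no
  finiteness argument.\<close>

lemma supercharacter_one:
  assumes "nontrivial_additive_character \<theta>"
  shows "nonnesting_supercharacter \<theta> I P \<eta> (matr_one I) =
    of_nat (card {\<phi>. \<phi> \<in> pattern_dual I P \<and> big P \<phi> = \<eta>})"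
proof -
  have "pattern_log I (matr_one I) = (\<lambda>i j. 0 :: 'a)" by (simp add: pattern_log_def)
  then show ?thesis
    by (simp add: nonnesting_supercharacter_def pattern_dual_zero additive_character_zero[OF assms])
qed

text \<open>A position contributes only if \<open>x\<close> and \<open>\<phi>\<close> are both
  nonzero there. It then lies under an arc of \<open>big P \<phi>\<close> and, by
  \<open>zero\<close>, is that arc; \<open>zero\<close> once more makes it minimal in the support of
  \<open>x\<close>. Only common arcs remain.\<close>

lemma dual_value:
  assumes \<phi>: "\<phi> \<in> pattern_dual I P" and x: "x \<in> pattern_algebra I P"
    and zero: "\<And>i a j k l. (i, a, j) \<in> big P \<phi> \<Longrightarrow> strictly_under P (k, l) (i, j) \<Longrightarrow>
      k \<prec>\<^bsub>P\<^esub> l \<Longrightarrow> x k l = 0"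
  shows "\<phi> x = (\<Sum>(i, j, a, b)\<in>{(i, j, a, b). (i, a, j) \<in> big P \<phi> \<and> (i, b, j) \<in> sml P x}. a * b)"
proof -
  let ?S = "{(i, j). i \<prec>\<^bsub>P\<^esub> j}"
  let ?T = "{(i, j, a, b). (i, a, j) \<in> big P \<phi> \<and> (i, b, j) \<in> sml P x}"
  let ?F = "\<lambda>(i, j). (i, j, \<phi> (matr_unit i j), x i j)"
  \<comment> \<open>The positions of common arcs. Their labels are determined by
    \<open>\<phi>\<close> and \<open>x\<close>, so \<open>?F\<close> maps this set bijectively onto
    \<open>?T\<close>.\<close>
  define S' where "S' = {(i, j). ?F (i, j) \<in> ?T}"
  have fin: "finite ?S" using finite_P by (rule rev_finite_subset) auto
  have outside: "x i j * \<phi> (matr_unit i j) = 0" if ij: "i \<prec>\<^bsub>P\<^esub> j" "(i, j) \<notin> S'" for i j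
  proof (rule ccontr)
    assume "x i j * \<phi> (matr_unit i j) \<noteq> 0"
    then have nz: "x i j \<noteq> 0" "\<phi> (matr_unit i j) \<noteq> 0" by auto
    obtain i' a' j' where b: "(i', a', j') \<in> big P \<phi>" "(i', i) \<in> P" "(j, j') \<in> P"
      using exists_big_above[OF ij(1), of \<phi>] nz(2) by blast
    have "(i', j') = (i, j)"
      using zero[OF b(1), of i j] nz ij(1) b by (auto simp: strictly_under_def)
    then have bij: "(i, \<phi> (matr_unit i j), j) \<in> big P \<phi>" using b unfolding big_iff by auto
    then have "(i, x i j, j) \<in> sml P x"
      unfolding sml_iff using ij(1) nz zero[OF bij] by blast
    then show False using ij(2) bij by (auto simp: S'_def)
  qed
  have "\<phi> x = (\<Sum>(i, j)\<in>?S. x i j * \<phi> (matr_unit i j))"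
    by (rule pattern_dual_expand[OF \<phi> x])
  also have "\<dots> = (\<Sum>(i, j)\<in>S'. x i j * \<phi> (matr_unit i j))"
  proof (rule sum.mono_neutral_right[OF fin])
    show "S' \<subseteq> ?S" by (auto simp: S'_def big_iff)
    show "\<forall>p\<in>?S - S'. (case p of (i, j) \<Rightarrow> x i j * \<phi> (matr_unit i j)) = 0"
      using outside by auto
  qed
  also have "\<dots> = (\<Sum>(i, j, a, b)\<in>?T. a * b)"
    by (rule sum.reindex_bij_witness[of _ "\<lambda>(i, j, a, b). (i, j)" ?F])
      (auto simp: S'_def big_iff sml_iff)
  finally show ?thesis .
qed

text \<open>Lets \<open>sml\<close> be computed from \<open>pattern_log I g\<close>, which differs
  from \<open>g\<close> only on the diagonal.\<close>

lemma sml_cong: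
  assumes "\<And>i j. i \<prec>\<^bsub>P\<^esub> j \<Longrightarrow> g i j = h i j"
  shows "sml P g = sml P h"
  using assms by (auto simp: sml_iff)

end

theorem proposition6p5:
  fixes I :: "'i set" and P :: "'i rel"
    and \<theta> :: "'a::{field,finite} \<Rightarrow> complex"
    and \<eta> \<nu> :: "('i, 'a) arc set"
    and g :: "('i, 'a) matr"
  assumes "finite I" and "partial_order_on I P"
    and "nontrivial_additive_character \<theta>"
    and "labeled_set_partition P \<eta>" and "nonnesting P \<eta>"
    and "labeled_set_partition P \<nu>" and "nonnesting P \<nu>"
    and "g \<in> nonnesting_superclass I P \<nu>"
  shows "nonnesting_supercharacter \<theta> I P \<eta> g =
    (if \<nexists>i a j k b l. (i, a, j) \<in> \<eta> \<and> (k, b, l) \<in> \<nu> \<and> (i, j) \<noteq> (k, l) \<and>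
          i \<preceq>\<^bsub>P\<^esub> k \<and> k \<prec>\<^bsub>P\<^esub> l \<and> l \<preceq>\<^bsub>P\<^esub> j
     then nonnesting_supercharacter \<theta> I P \<eta> \<one>\<^bsub>pattern_group I P\<^esub> *
       (\<Prod>(i, j, a, b) \<in> {(i, j, a, b). (i, a, j) \<in> \<eta> \<and> (i, b, j) \<in> \<nu>}. \<theta> (a * b))
     else 0)"
    (is "_ = (if ?C then _ * ?prod else 0)")
proof -
  interpret finite_poset I P by unfold_locales (fact assms)+
  let ?x = "pattern_log I g"
  have x: "?x \<in> pattern_algebra I P"
    using assms(8) by (auto simp: nonnesting_superclass_def pattern_group_def pattern_log_one_plus)
  have "sml P ?x = sml P g"
    by (rule sml_cong) (auto simp: pattern_log_def matr_one_def)
  then have \<nu>: "sml P ?x = \<nu>" using assms(8) by (simp add: nonnesting_superclass_def)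
  show ?thesis
  proof (cases ?C)
    case True
    \<comment> \<open>The case assumption speaks only of arcs of \<open>\<nu>\<close>. Below any
      nonzero entry there is such an arc, and it lies strictly under the same arc of
      \<open>\<eta>\<close>.\<close>
    have zero: "?x k l = 0"
      if arc: "(i, a, j) \<in> \<eta>" "strictly_under P (k, l) (i, j)" and kl: "k \<prec>\<^bsub>P\<^esub> l" for i a j k l
    proof (rule ccontr)
      assume "?x k l \<noteq> 0"
      then obtain k' l' where s: "(k', ?x k' l', l') \<in> \<nu>" "(k, k') \<in> P" "(l', l) \<in> P"
        using exists_sml_below[OF kl, of ?x] \<nu> by metis
      have "strictly_under P (k', l') (i, j)"
        using arc(2) s strictly_under_trans[of "(k', l')" "(k, l)" "(i, j)"]
        by (cases "(k', l') = (k, l)") (auto simp: strictly_under_def)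
      moreover have "k' \<prec>\<^bsub>P\<^esub> l'" using s(1) sml_iff \<nu> by metis
      ultimately show False using True arc(1) s(1) unfolding strictly_under_def by fastforce
    qed
    \<comment> \<open>The value does not depend on \<open>\<phi>\<close>, so the supercharacter is
      this constant times the number of functionals, which is its value at the identity.\<close>
    have "\<theta> (\<phi> ?x) = ?prod" if "\<phi> \<in> pattern_dual I P" "big P \<phi> = \<eta>" for \<phi>
    proof -
      have "\<phi> ?x = (\<Sum>(i, j, a, b)\<in>{(i, j, a, b). (i, a, j) \<in> \<eta> \<and> (i, b, j) \<in> \<nu>}. a * b)"
        using dual_value[OF that(1) x] zero that(2) \<nu> by blast
      then show ?thesis by (simp add: additive_character_sum[OF assms(3)] case_prod_beta)
    qed
    then have "nonnesting_supercharacter \<theta> I P \<eta> g =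
        of_nat (card {\<phi>. \<phi> \<in> pattern_dual I P \<and> big P \<phi> = \<eta>}) * ?prod"
      by (simp add: nonnesting_supercharacter_def)
    then show ?thesis
      using True by (simp add: supercharacter_one[OF assms(3)] pattern_group_def)
  next
    case False
    then obtain i a j k b l where arc: "(i, a, j) \<in> \<eta>" "(k, b, l) \<in> \<nu>" "strictly_under P (k, l) (i, j)"
      unfolding strictly_under_def by fastforce
    \<comment> \<open>The offending arc of \<open>\<nu>\<close> supplies the nonzero entry at a free
      pair that makes the translation argument apply.\<close>
    then have "?x k l \<noteq> 0" using \<nu> sml_iff by metis
    then show ?thesis
      by (subst if_not_P[OF False]) (rule supercharacter_eq_zero[OF assms(3-5) arc(1,3) x])
  qed
qed

end
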